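(* Let $\varepsilon_{\hat I}=(\varepsilon_i)_{i\in\hat I}$ satisfy $0<\varepsilon_i<g_i^{ec.\min}-d$ for all $i\in\hat I$. (i) If $P^+\cap\breve P^+(\varepsilon_{\hat I})\ne\emptyset$, then $P^+\subset\breve P^+(\varepsilon_{\hat I})$, and, for all sufficiently small $\varepsilon_i>0$, $i\in\hat I$, every $\tilde p^+\in\breve P^+(\varepsilon_{\hat I})$ satisfies the following: either $\tilde p^+\in P^+$, or $p^+<\tilde p^+$ for all $p^+\in P^+$. (ii) If $P^+\cap\breve P^+(\varepsilon_{\hat I})=\emptyset$, then $p^+<\tilde p^+$ for all $p^+\in P^+$ and all $\tilde p^+\in\breve P^+(\varepsilon_{\hat I})$.
   Context: Market data: $I=\{1,\dots,|I|\}$ is a finite nonempty set of generating units; for each $i\in I$: $g_i^{\max}>0$, $w_i\ge 0$, and $c_i:[0,g_i^{\max}]\to\mathbb{R}$ is a non-decreasing convex continuous function with $c_i(0)=0$. The demand $d$ is a fixed real number with $0\le d\le\sum_{i\in I}g_i^{\max}$. For $x_i=(u_i,g_i)$ the cost is $C_i(x_i)=c_i(g_i)+w_iu_i$, and the private feasible set is $X_i=\{(u_i,g_i): u_i\in\{0,1\},\ g_i\in\mathbb{R},\ 0\le g_i\le u_ig_i^{\max}\}$. Minimum economic output $g_i^{ec.\min}$: if $w_i=0$, then $g_i^{ec.\min}=0$; if $w_i\ne0$, then $g_i^{ec.\min}$ is the lowest $g\in(0,g_i^{\max})$ satisfying $[w_i+c_i(g)]/g\in\partial c_i(g)$ (subdifferential),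 and $g_i^{ec.\min}=g_i^{\max}$ if there is no such $g$. Let $\bar g_i^{\max}=\min(d;g_i^{\max})$. The set $I$ is partitioned into $\breve I=\{i\in I: g_i^{ec.\min}\le\bar g_i^{\max}\}$ and $\hat I=\{i\in I: g_i^{ec.\min}>\bar g_i^{\max}\}$ (units in $\hat I$ satisfy $g_i^{ec.\min}>d$; $\hat I$ may be empty). For $p\in\mathbb{R}$ and $\varepsilon_i>0$: $\hat X_i(\varepsilon_i)=\{(u_i,g_i)\in X_i: g_i\le\bar g_i^{\max}+\varepsilon_i\}$, $\pi_i(p)=\max_{x_i\in X_i}[pg_i-C_i(x_i)]$, $\hat\pi_i(p,\varepsilon_i)=\max_{x_i\in\hat X_i(\varepsilon_i)}[pg_i-C_i(x_i)]$. $P^+$ (the set of convex hull prices) is the set of maximizers over $p\in\mathbb{R}$ of $pd-\sum_{i\in I}\pi_i(p)$. $\breve P^+(\varepsilon_{\hat I})$ (the set of prices of the modified convex hull pricing method) is the set of maximizers over $p\in\mathbb{R}$ of $pd-\sum_{i\in\breve I}\pi_i(p)-\sum_{i\in\hat I}\hat\pi_i(p,\varepsilon_i)$. "For all sufficiently small $\varepsilon_i>0$, $i\in\hat I$" means: there is $\varepsilon_0>0$ such that the assertion holds whenever $0<\varepsilon_i<\varepsilon_0$ for all $i\in\hat I$. *)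

theory Defs
  imports "HOL-Analysis.Analysis"
begin

text \<open>
  The data of a generating unit are its capacity \<open>gm\<close>, its no-load cost \<open>w\<close> and its variable cost
  \<open>c\<close>, of which only the values on \<open>{0..gm}\<close> matter. A market has a set \<open>I\<close> of units, families
  \<open>gmax\<close>, \<open>w\<close>, \<open>c\<close> of unit data indexed by \<open>I\<close>, and a demand \<open>d\<close>. A production decision is a pair
  \<open>(u, g)\<close> of commitment status and output.
\<close>

definition subdifferential_on :: "real set \<Rightarrow> (real \<Rightarrow> real) \<Rightarrow> real \<Rightarrow> real set" where
  "subdifferential_on S f x = {s. \<forall>y\<in>S. f y \<ge> f x + s * (y - x)}"

definition unit_cost :: "real \<Rightarrow> (real \<Rightarrow> real) \<Rightarrow> real \<times> real \<Rightarrow> real" where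
  "unit_cost w c = (\<lambda>(u, g). c g + w * u)"

definition feasible :: "real \<Rightarrow> (real \<times> real) set" where
  "feasible gm = {(u, g). u \<in> {0, 1} \<and> 0 \<le> g \<and> g \<le> u * gm}"

text \<open>
  For \<open>w > 0\<close> and \<open>c\<close> convex and continuous with \<open>c 0 = 0\<close>, the set of outputs below is closed in
  \<open>{0<..<gm}\<close> and bounded away from \<open>0\<close>, so its least element exists whenever it is nonempty.
\<close>

definition ec_min :: "real \<Rightarrow> real \<Rightarrow> (real \<Rightarrow> real) \<Rightarrow> real" where
  "ec_min gm w c =
    (let Q = (\<lambda>g. g \<in> {0<..<gm} \<and> (w + c g) / g \<in> subdifferential_on {0..gm} c g)
     in if w = 0 then 0 else if \<exists>g. Q g then (LEAST g. Q g) else gm)"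

definition units_breve ::
  "'i set \<Rightarrow> ('i \<Rightarrow> real) \<Rightarrow> ('i \<Rightarrow> real) \<Rightarrow> ('i \<Rightarrow> real \<Rightarrow> real) \<Rightarrow> real \<Rightarrow> 'i set" where
  "units_breve I gmax w c d = {i \<in> I. ec_min (gmax i) (w i) (c i) \<le> min d (gmax i)}"

definition units_hat ::
  "'i set \<Rightarrow> ('i \<Rightarrow> real) \<Rightarrow> ('i \<Rightarrow> real) \<Rightarrow> ('i \<Rightarrow> real \<Rightarrow> real) \<Rightarrow> real \<Rightarrow> 'i set" where
  "units_hat I gmax w c d = {i \<in> I. ec_min (gmax i) (w i) (c i) > min d (gmax i)}"

definition feasible_hat :: "real \<Rightarrow> real \<Rightarrow> real \<Rightarrow> (real \<times> real) set" where
  "feasible_hat gm d e = {x \<in> feasible gm. snd x \<le> min d gm + e}"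

text \<open>
  The suprema in the two profit functions are maxima: the feasible sets are nonempty and compact,
  and the objective is continuous on them when \<open>c\<close> is continuous on \<open>{0..gm}\<close>.
\<close>

definition profit :: "real \<Rightarrow> real \<Rightarrow> (real \<Rightarrow> real) \<Rightarrow> real \<Rightarrow> real" where
  "profit gm w c p = (SUP x\<in>feasible gm. p * snd x - unit_cost w c x)"

definition profit_hat ::
  "real \<Rightarrow> real \<Rightarrow> (real \<Rightarrow> real) \<Rightarrow> real \<Rightarrow> real \<Rightarrow> real \<Rightarrow> real" where
  "profit_hat gm w c d p e = (SUP x\<in>feasible_hat gm d e. p * snd x - unit_cost w c x)"

definition ch_prices ::
  "'i set \<Rightarrow> ('i \<Rightarrow> real) \<Rightarrow> ('i \<Rightarrow> real) \<Rightarrow> ('i \<Rightarrow> real \<Rightarrow> real) \<Rightarrow> real \<Rightarrow> real set" where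
  "ch_prices I gmax w c d =
    (let L = (\<lambda>p. p * d - (\<Sum>i\<in>I. profit (gmax i) (w i) (c i) p))
     in {p. \<forall>q. L q \<le> L p})"

definition modified_ch_prices ::
  "'i set \<Rightarrow> ('i \<Rightarrow> real) \<Rightarrow> ('i \<Rightarrow> real) \<Rightarrow> ('i \<Rightarrow> real \<Rightarrow> real) \<Rightarrow> real \<Rightarrow> ('i \<Rightarrow> real) \<Rightarrow> real set" where
  "modified_ch_prices I gmax w c d \<epsilon> =
    (let L = (\<lambda>p. p * d
                 - (\<Sum>i\<in>units_breve I gmax w c d. profit (gmax i) (w i) (c i) p)
                 - (\<Sum>i\<in>units_hat I gmax w c d. profit_hat (gmax i) (w i) (c i) d p (\<epsilon> i)))
     in {p. \<forall>q. L q \<le> L p})"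

end

theory Submission
  imports Defs
begin

text \<open>
  The modified dual function is the original one plus the function \<open>D\<close> that sums
  \<open>profit - profit_hat\<close> over the units of \<open>units_hat\<close>. Everything follows from two properties of \<open>D\<close>:
  it is non-decreasing, and it vanishes at every convex hull price.

  Both come from the break-even price \<open>p\<^sub>0 = (w + c G) / G\<close> of a unit, where \<open>G\<close> is its minimum
  economic output. At \<open>G\<close> the average cost is minimal, and equivalently \<open>p\<^sub>0\<close> is a subgradient of \<open>c\<close>
  at \<open>G\<close> (lemma \<open>average_cost_subgradient_iff\<close>). Up to \<open>p\<^sub>0\<close> no output earns a positive
  profit, so both profit functions are zero. From \<open>p\<^sub>0\<close> on, some optimal output is at least \<open>G\<close>, so that
  \<open>profit\<close> grows at rate at least \<open>G\<close>, whereas \<open>profit_hat\<close> grows at most at the rate of its output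
  bound \<open>d + e < G\<close>. So each summand of \<open>D\<close> is non-decreasing. Moreover \<open>G > d\<close>, and the profits of
  the other units do not decrease, so the original dual function falls strictly
  beyond \<open>p\<^sub>0\<close>. Hence convex hull prices do not exceed the break-even price of any unit in \<open>units_hat\<close>,
  where \<open>D\<close> is zero.

  Now let \<open>p\<close> be a convex hull price and \<open>p' \<le> p\<close> a modified one. Passing from \<open>p\<close> to \<open>p'\<close> raises
  neither the original dual function nor \<open>D\<close>, yet it must not lower their sum; so it leaves both
  unchanged and \<open>p'\<close> is a convex hull price too. And if one convex hull price maximizes the sum, they all do,
  as \<open>D\<close> is zero at each of them.
\<close>

section \<open>Minimum economic output and break-even price\<close>

text \<open>
  A line of slope \<open>(w + c g) / g\<close> through the graph point of \<open>w + c\<close> at \<open>g\<close> passes through the origin.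
  It supports \<open>w + c\<close> from below exactly when no other output has a smaller average cost.
\<close>
lemma average_cost_subgradient_iff:
  fixes c :: "real \<Rightarrow> real"
  assumes "0 \<le> w" "c 0 = 0" "0 < g"
  shows "(w + c g) / g \<in> subdifferential_on {0..gm} c g \<longleftrightarrow>
    (\<forall>y\<in>{0<..gm}. (w + c g) / g \<le> (w + c y) / y)"
proof -
  have line: "c y \<ge> c g + (w + c g) / g * (y - g) \<longleftrightarrow> (w + c g) / g * y \<le> w + c y" for y
    using \<open>0 < g\<close> by (simp add: field_simps)
  have ray: "(w + c g) / g * y \<le> w + c y \<longleftrightarrow> (w + c g) / g \<le> (w + c y) / y" if "0 < y" for y
    using that by (simp add: pos_le_divide_eq)
  have "(\<forall>y\<in>{0..gm}. (w + c g) / g * y \<le> w + c y) \<longleftrightarrow>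
      (\<forall>y\<in>{0<..gm}. (w + c g) / g * y \<le> w + c y)"
  proof (intro iffI ballI)
    fix y assume *: "\<forall>y\<in>{0<..gm}. (w + c g) / g * y \<le> w + c y" and "y \<in> {0..gm}"
    then show "(w + c g) / g * y \<le> w + c y"
      using assms by (cases "y = 0") auto
  qed auto
  also have "\<dots> \<longleftrightarrow> (\<forall>y\<in>{0<..gm}. (w + c g) / g \<le> (w + c y) / y)"
    using ray by auto
  finally show ?thesis
    unfolding subdifferential_on_def mem_Collect_eq line .
qed

text \<open>
  The average cost attains its minimum on \<open>{0<..gm}\<close> because it is at least \<open>w / g\<close>,
  which blows up at \<open>0\<close>; the minimizers form a compact set, and its least element is \<open>ec_min\<close>,
  including the case in which \<open>gm\<close> is the only minimizer.
\<close>
lemma ec_min_break_even: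
  fixes c :: "real \<Rightarrow> real"
  assumes "0 < gm" "0 < w" "c 0 = 0"
    and c_nonneg: "\<And>g. g \<in> {0..gm} \<Longrightarrow> 0 \<le> c g"
    and cont: "continuous_on {0..gm} c"
  shows "0 < ec_min gm w c" "ec_min gm w c \<le> gm"
    and "(w + c (ec_min gm w c)) / ec_min gm w c \<in> subdifferential_on {0..gm} c (ec_min gm w c)"
proof -
  define F where "F g = (w + c g) / g" for g
  define K where "K = {w / F gm..gm}"
  have F_gm: "0 < F gm"
    using assms(1,2) c_nonneg[of gm] by (simp add: F_def)
  have "0 < w / F gm"
    using F_gm \<open>0 < w\<close> by simp
  have F_lower: "w \<le> F g * g" if "g \<in> {0<..gm}" for g
    using that c_nonneg[of g] by (simp add: F_def)
  \<comment> \<open>Below \<open>w / F gm\<close> the average cost already exceeds its value at \<open>gm\<close>.\<close>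
  have in_K: "g \<in> K" if "g \<in> {0<..gm}" "F g \<le> F gm" for g
  proof -
    have "w \<le> F gm * g"
      using F_lower[OF that(1)]
      by (rule order_trans) (use that in \<open>auto intro: mult_right_mono\<close>)
    then show ?thesis
      using that F_gm by (simp add: K_def pos_divide_le_eq mult.commute)
  qed
  have gm_K: "gm \<in> K"
    using in_K[of gm] \<open>0 < gm\<close> by simp
  have K_sub: "K \<subseteq> {0<..gm}"
    using \<open>0 < w / F gm\<close> by (auto simp: K_def)
  have cont_F: "continuous_on K F"
    unfolding F_def using K_sub
    by (intro continuous_intros continuous_on_subset[OF cont]) auto
  obtain m where m: "m \<in> K" "\<And>y. y \<in> K \<Longrightarrow> F m \<le> F y"
  proof -
    have "compact K" "K \<noteq> {}"
      using gm_K by (auto simp: K_def)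
    then show ?thesis
      using continuous_attains_inf[OF _ _ cont_F] that by blast
  qed
  have F_min: "F m \<le> F y" if "y \<in> {0<..gm}" for y
    using m(2)[OF in_K[OF that]] m(2)[OF gm_K] by (cases "F y \<le> F gm") auto
  define M where "M = K \<inter> F -` {..F m}"
  have "closed M"
    unfolding M_def using cont_F
    by (rule continuous_closed_preimage) (simp_all add: K_def)
  then have "compact (K \<inter> M)"
    by (intro compact_Int_closed) (simp_all add: K_def)
  then have "compact M"
    by (simp add: M_def)
  moreover have "M \<noteq> {}"
    using m(1) by (auto simp: M_def)
  ultimately obtain g where g: "g \<in> M" "\<And>y. y \<in> M \<Longrightarrow> g \<le> y"
    using compact_attains_inf[of M] by blast
  have g_dom: "0 < g" "g \<le> gm"
    using g(1) K_sub by (auto simp: M_def)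
  have subgrad_iff: "F y \<in> subdifferential_on {0..gm} c y \<longleftrightarrow> y \<in> M" if "y \<in> {0<..gm}" for y
  proof -
    have "F y \<in> subdifferential_on {0..gm} c y \<longleftrightarrow> (\<forall>z\<in>{0<..gm}. F y \<le> F z)"
      using average_cost_subgradient_iff[of w c y gm] assms that by (simp add: F_def)
    also have "\<dots> \<longleftrightarrow> y \<in> M"
    proof
      assume le: "\<forall>z\<in>{0<..gm}. F y \<le> F z"
      then have "F y \<le> F m" "F y \<le> F gm"
        using m(1) gm_K K_sub by blast+
      then show "y \<in> M"
        using in_K[OF that] by (simp add: M_def)
    next
      assume "y \<in> M"
      then show "\<forall>z\<in>{0<..gm}. F y \<le> F z"
        using order_trans[OF _ F_min] unfolding M_def by blast
    qed
    finally show ?thesis .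
  qed
  have "ec_min gm w c = g"
  proof -
    define Q where "Q = (\<lambda>y. y \<in> {0<..<gm} \<and> (w + c y) / y \<in> subdifferential_on {0..gm} c y)"
    have ec: "ec_min gm w c = (if \<exists>y. Q y then LEAST y. Q y else gm)"
      unfolding Q_def ec_min_def Let_def by (rule if_not_P) (use \<open>0 < w\<close> in simp)
    have Q_M: "Q y \<longleftrightarrow> y \<in> M \<and> y < gm" for y
      using subgrad_iff[of y] K_sub by (auto simp: Q_def M_def F_def)
    show ?thesis
    proof (cases "g < gm")
      case True
      then have "Q g" using g(1) Q_M by simp
      then have "ec_min gm w c = (LEAST y. Q y)"
        unfolding ec by (intro if_P exI)
      also have "\<dots> = g"
        by (rule Least_equality) (use \<open>Q g\<close> g(2) Q_M in \<open>simp_all\<close>)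
      finally show ?thesis .
    next
      case False
      then have "\<not> Q y" for y using g(2)[of y] Q_M[of y] by auto
      with False g_dom show ?thesis using ec by simp
    qed
  qed
  moreover have "F g \<in> subdifferential_on {0..gm} c g"
    using subgrad_iff[of g] g(1) g_dom by simp
  ultimately show "0 < ec_min gm w c" "ec_min gm w c \<le> gm"
    "(w + c (ec_min gm w c)) / ec_min gm w c \<in> subdifferential_on {0..gm} c (ec_min gm w c)"
    using g_dom by (simp_all add: F_def)
qed

section \<open>Growth of profit functions in the price\<close>

text \<open>
  The common form of \<open>profit\<close> and \<open>profit_hat\<close>, which differ only in the set of admissible decisions.
\<close>
definition best_profit :: "(real \<times> real) set \<Rightarrow> real \<Rightarrow> (real \<Rightarrow> real) \<Rightarrow> real \<Rightarrow> real" where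
  "best_profit Y w c p = (SUP x\<in>Y. p * snd x - unit_cost w c x)"

lemma profit_eq_best_profit: "profit gm w c = best_profit (feasible gm) w c"
  by (simp add: fun_eq_iff profit_def best_profit_def)

lemma profit_hat_eq_best_profit: "profit_hat gm w c d p e = best_profit (feasible_hat gm d e) w c p"
  by (simp add: profit_hat_def best_profit_def)

locale unit_data =
  fixes gm w :: real and c :: "real \<Rightarrow> real"
  assumes gm_pos: "0 < gm" and w_nonneg: "0 \<le> w" and c_zero: "c 0 = 0"
    and c_nonneg: "\<And>g. g \<in> {0..gm} \<Longrightarrow> 0 \<le> c g"
begin

lemma feasible_output: "x \<in> feasible gm \<Longrightarrow> snd x \<in> {0..gm}"
  using gm_pos by (auto simp: feasible_def)

lemma shutdown_feasible: "(0, 0) \<in> feasible gm"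
  by (simp add: feasible_def)

lemma shutdown_cost: "unit_cost w c (0, 0) = 0"
  by (simp add: unit_cost_def c_zero)

lemma unit_cost_nonneg: "x \<in> feasible gm \<Longrightarrow> 0 \<le> unit_cost w c x"
proof -
  assume x: "x \<in> feasible gm"
  obtain u g where ug: "x = (u, g)" by (cases x)
  have "0 \<le> c g"
    using c_nonneg[of g] feasible_output[OF x] ug by simp
  moreover have "0 \<le> u"
    using x ug by (auto simp: feasible_def)
  ultimately show ?thesis
    using w_nonneg ug by (simp add: unit_cost_def)
qed

lemma profit_values_bdd_above:
  assumes "Y \<subseteq> feasible gm"
  shows "bdd_above ((\<lambda>x. p * snd x - unit_cost w c x) ` Y)"
proof (rule bdd_aboveI2)
  fix x assume "x \<in> Y"
  then have x: "x \<in> feasible gm" using assms by auto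
  have "p * snd x \<le> \<bar>p\<bar> * gm"
    using feasible_output[OF x] gm_pos by (intro mult_mono) auto
  then show "p * snd x - unit_cost w c x \<le> \<bar>p\<bar> * gm"
    using unit_cost_nonneg[OF x] by linarith
qed

lemma best_profit_ge:
  assumes "Y \<subseteq> feasible gm" "x \<in> Y"
  shows "p * snd x - unit_cost w c x \<le> best_profit Y w c p"
  unfolding best_profit_def
  by (rule cSUP_upper[OF assms(2) profit_values_bdd_above[OF assms(1)]])

lemma best_profit_le:
  assumes "Y \<noteq> {}" "\<And>x. x \<in> Y \<Longrightarrow> p * snd x - unit_cost w c x \<le> b"
  shows "best_profit Y w c p \<le> b"
  unfolding best_profit_def using assms by (rule cSUP_least)

lemma best_profit_growth_le:
  assumes "Y \<subseteq> feasible gm" "Y \<noteq> {}" "\<And>x. x \<in> Y \<Longrightarrow> snd x \<le> s" "p \<le> q"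
  shows "best_profit Y w c q \<le> best_profit Y w c p + s * (q - p)"
proof (rule best_profit_le[OF assms(2)])
  fix x assume x: "x \<in> Y"
  have "snd x * (q - p) \<le> s * (q - p)"
    using assms(3)[OF x] \<open>p \<le> q\<close> by (intro mult_right_mono) auto
  then show "q * snd x - unit_cost w c x \<le> best_profit Y w c p + s * (q - p)"
    using best_profit_ge[OF assms(1) x, of p] by (simp add: algebra_simps)
qed

text \<open>
  If at price \<open>p\<close> the decisions with output at least \<open>s\<close> are as good as all others, then
  raising the price gains at least \<open>s\<close> per unit of price, because such a decision can be kept.
\<close>
lemma best_profit_growth_ge:
  assumes "Y \<subseteq> feasible gm" "Y \<noteq> {}" "p \<le> q"
    and dominated: "\<And>x. x \<in> Y \<Longrightarrow>
      \<exists>y\<in>Y. s \<le> snd y \<and> p * snd x - unit_cost w c x \<le> p * snd y - unit_cost w c y"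
  shows "best_profit Y w c p + s * (q - p) \<le> best_profit Y w c q"
proof -
  have "best_profit Y w c p \<le> best_profit Y w c q - s * (q - p)"
  proof (rule best_profit_le[OF assms(2)])
    fix x assume "x \<in> Y"
    then obtain y where y: "y \<in> Y" "s \<le> snd y"
      "p * snd x - unit_cost w c x \<le> p * snd y - unit_cost w c y"
      using dominated by blast
    have "s * (q - p) \<le> snd y * (q - p)"
      using y(2) \<open>p \<le> q\<close> by (intro mult_right_mono) auto
    then show "p * snd x - unit_cost w c x \<le> best_profit Y w c q - s * (q - p)"
      using best_profit_ge[OF assms(1) y(1), of q] y(3) by (simp add: algebra_simps)
  qed
  then show ?thesis by simp
qed

lemma profit_mono:
  assumes "p \<le> q"
  shows "profit gm w c p \<le> profit gm w c q"
proof -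
  have "best_profit (feasible gm) w c p + 0 * (q - p) \<le> best_profit (feasible gm) w c q"
  proof (rule best_profit_growth_ge)
    fix x assume x: "x \<in> feasible gm"
    then show "\<exists>y\<in>feasible gm. 0 \<le> snd y \<and>
        p * snd x - unit_cost w c x \<le> p * snd y - unit_cost w c y"
      using feasible_output[OF x] by (intro bexI[of _ x]) auto
  qed (use assms shutdown_feasible in auto)
  then show ?thesis by (simp add: profit_eq_best_profit)
qed

end

section \<open>Units with a positive no-load cost\<close>

locale unit_with_no_load_cost = unit_data +
  assumes w_pos: "0 < w" and c_cont: "continuous_on {0..gm} c"
begin

definition break_even_price :: real where
  "break_even_price = (w + c (ec_min gm w c)) / ec_min gm w c"

lemma ec_min_pos: "0 < ec_min gm w c"
  and ec_min_le: "ec_min gm w c \<le> gm"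
  and break_even_subgradient:
    "break_even_price \<in> subdifferential_on {0..gm} c (ec_min gm w c)"
  using ec_min_break_even[OF gm_pos w_pos c_zero c_nonneg c_cont]
  by (simp_all add: break_even_price_def)

lemma break_even_price_ec_min:
  "break_even_price * ec_min gm w c = w + c (ec_min gm w c)"
  using ec_min_pos by (simp add: break_even_price_def)

lemma break_even_supporting_line:
  assumes "g \<in> {0..gm}"
  shows "break_even_price * g \<le> w + c g"
  using break_even_subgradient assms break_even_price_ec_min
  by (auto simp: subdifferential_on_def algebra_simps)

lemma best_profit_below_break_even:
  assumes "Y \<subseteq> feasible gm" "(0, 0) \<in> Y" "p \<le> break_even_price"
  shows "best_profit Y w c p = 0"
proof (rule antisym)
  show "best_profit Y w c p \<le> 0"
  proof (rule best_profit_le)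
    fix x assume "x \<in> Y"
    then have x: "x \<in> feasible gm" using assms(1) by auto
    then have g: "snd x \<in> {0..gm}" by (rule feasible_output)
    obtain u g where ug: "x = (u, g)" by (cases x)
    have "p * g \<le> break_even_price * g"
      using assms(3) g ug by (intro mult_right_mono) auto
    then show "p * snd x - unit_cost w c x \<le> 0"
      using break_even_supporting_line[OF g] x ug
      by (auto simp: feasible_def unit_cost_def c_zero)
  qed (use assms in auto)
  show "0 \<le> best_profit Y w c p"
    using best_profit_ge[OF assms(1,2), of p] by (simp add: shutdown_cost)
qed

text \<open>
  Above the break-even price, running at the minimum economic output is at least as good as
  any smaller output: at the break-even price it earns zero, which is the maximum there, and it
  gains at least as much from the price increase.
\<close>
lemma profit_growth_above_break_even:
  assumes "break_even_price \<le> p" "p \<le> q"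
  shows "profit gm w c p + ec_min gm w c * (q - p) \<le> profit gm w c q"
  unfolding profit_eq_best_profit
proof (rule best_profit_growth_ge)
  let ?G = "ec_min gm w c"
  fix x assume x: "x \<in> feasible gm"
  obtain u g where ug: "x = (u, g)" by (cases x)
  have g: "g \<in> {0..gm}" using feasible_output[OF x] ug by simp
  show "\<exists>y\<in>feasible gm. ?G \<le> snd y \<and> p * snd x - unit_cost w c x \<le> p * snd y - unit_cost w c y"
  proof (cases "?G \<le> g")
    case True
    then show ?thesis using x ug by (intro bexI[of _ x]) auto
  next
    case False
    have "(1, ?G) \<in> feasible gm"
      using ec_min_pos ec_min_le by (simp add: feasible_def)
    moreover have "p * g - unit_cost w c x \<le> p * ?G - unit_cost w c (1, ?G)"
    proof -
      have "p * g - unit_cost w c x \<le> (p - break_even_price) * g"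
        using break_even_supporting_line[OF g] x ug
        by (auto simp: feasible_def unit_cost_def c_zero algebra_simps)
      also have "\<dots> \<le> (p - break_even_price) * ?G"
        using assms(1) False by (intro mult_left_mono) auto
      also have "\<dots> = p * ?G - unit_cost w c (1, ?G)"
        using break_even_price_ec_min by (simp add: unit_cost_def algebra_simps)
      finally show ?thesis .
    qed
    ultimately show ?thesis using ug by (intro bexI[of _ "(1, ?G)"]) auto
  qed
qed (use assms shutdown_feasible in auto)

context
  fixes d e :: real
  assumes d_nonneg: "0 \<le> d" and e_pos: "0 < e" and e_small: "e < ec_min gm w c - d"
begin

lemma feasible_hat_subset: "feasible_hat gm d e \<subseteq> feasible gm"
  by (auto simp: feasible_hat_def)

lemma shutdown_feasible_hat: "(0, 0) \<in> feasible_hat gm d e"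
  using gm_pos d_nonneg e_pos by (simp add: feasible_hat_def shutdown_feasible)

lemma profit_eq_profit_hat_below_break_even:
  assumes "p \<le> break_even_price"
  shows "profit gm w c p = profit_hat gm w c d p e"
  unfolding profit_eq_best_profit profit_hat_eq_best_profit
  using best_profit_below_break_even[OF _ _ assms]
    feasible_hat_subset shutdown_feasible_hat shutdown_feasible by simp

text \<open>
  The difference is zero up to the break-even price. Beyond it, growth at rate at least
  \<open>ec_min gm w c\<close> is compared with growth at rate at most \<open>d + e\<close>.
\<close>
lemma profit_minus_profit_hat_mono:
  "mono (\<lambda>p. profit gm w c p - profit_hat gm w c d p e)" (is "mono ?D")
proof (rule monoI)
  have above: "?D p \<le> ?D q" if "break_even_price \<le> p" "p \<le> q" for p q
  proof -
    have "profit_hat gm w c d q e \<le> profit_hat gm w c d p e + (d + e) * (q - p)"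
      unfolding profit_hat_eq_best_profit
      using feasible_hat_subset shutdown_feasible_hat that(2)
      by (intro best_profit_growth_le) (auto simp: feasible_hat_def)
    moreover have "(d + e) * (q - p) \<le> ec_min gm w c * (q - p)"
      using e_small that(2) by (intro mult_right_mono) auto
    ultimately show ?thesis
      using profit_growth_above_break_even[OF that] by linarith
  qed
  have below: "?D p = 0" if "p \<le> break_even_price" for p
    using profit_eq_profit_hat_below_break_even[OF that] by simp
  fix p q :: real assume "p \<le> q"
  show "?D p \<le> ?D q"
  proof (cases "break_even_price \<le> p")
    case True
    then show ?thesis using above \<open>p \<le> q\<close> by blast
  next
    case False
    then show ?thesis
      using below[of p] below[of q] below[of break_even_price] above[of break_even_price q]
      by (cases "q \<le> break_even_price") auto
  qed
qed

end

end

section \<open>Markets\<close>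

locale market =
  fixes I :: "'i set"
    and gmax w :: "'i \<Rightarrow> real"
    and c :: "'i \<Rightarrow> real \<Rightarrow> real"
    and d :: real
  assumes finite_units: "finite I"
    and gmax_pos: "\<And>i. i \<in> I \<Longrightarrow> 0 < gmax i"
    and w_nonneg: "\<And>i. i \<in> I \<Longrightarrow> 0 \<le> w i"
    and c_mono: "\<And>i. i \<in> I \<Longrightarrow> mono_on {0..gmax i} (c i)"
    and c_cont: "\<And>i. i \<in> I \<Longrightarrow> continuous_on {0..gmax i} (c i)"
    and c_zero: "\<And>i. i \<in> I \<Longrightarrow> c i 0 = 0"
    and d_nonneg: "0 \<le> d"
begin

abbreviation "I_hat \<equiv> units_hat I gmax w c d"
abbreviation "I_breve \<equiv> units_breve I gmax w c d"

abbreviation "output_min i \<equiv> ec_min (gmax i) (w i) (c i)"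
abbreviation "\<pi> i p \<equiv> profit (gmax i) (w i) (c i) p"
abbreviation "\<pi>_hat i p e \<equiv> profit_hat (gmax i) (w i) (c i) d p e"

definition dual :: "real \<Rightarrow> real" where
  "dual p = p * d - (\<Sum>i\<in>I. \<pi> i p)"

definition profit_gap :: "('i \<Rightarrow> real) \<Rightarrow> real \<Rightarrow> real" where
  "profit_gap e p = (\<Sum>i\<in>I_hat. \<pi> i p - \<pi>_hat i p (e i))"

definition admissible :: "('i \<Rightarrow> real) \<Rightarrow> bool" where
  "admissible e \<longleftrightarrow> (\<forall>i\<in>I_hat. 0 < e i \<and> e i < output_min i - d)"

lemma ch_prices_iff: "p \<in> ch_prices I gmax w c d \<longleftrightarrow> (\<forall>q. dual q \<le> dual p)"
  by (simp add: ch_prices_def Let_def dual_def)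

lemma modified_ch_prices_iff:
  "p \<in> modified_ch_prices I gmax w c d e \<longleftrightarrow>
    (\<forall>q. dual q + profit_gap e q \<le> dual p + profit_gap e p)"
proof -
  have split: "I = I_breve \<union> I_hat" and disjoint: "I_breve \<inter> I_hat = {}"
    by (auto simp: units_hat_def units_breve_def)
  have "finite I_breve" "finite I_hat"
    using finite_units by (auto simp: units_hat_def units_breve_def)
  then have "sum f I = sum f I_breve + sum f I_hat" for f :: "'i \<Rightarrow> real"
    using sum.union_disjoint[OF _ _ disjoint, of f] unfolding split[symmetric] by blast
  then have "p * d - (\<Sum>i\<in>I_breve. \<pi> i p) - (\<Sum>i\<in>I_hat. \<pi>_hat i p (e i)) =
      dual p + profit_gap e p" for p
    by (simp add: dual_def profit_gap_def sum_subtractf)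
  then show ?thesis by (simp add: modified_ch_prices_def Let_def)
qed

lemma unit_data_unit: "i \<in> I \<Longrightarrow> unit_data (gmax i) (w i) (c i)"
proof
  fix g assume "i \<in> I" "g \<in> {0..gmax i}"
  then show "0 \<le> c i g"
    using mono_onD[OF c_mono, of i 0 g] c_zero[of i] by auto
qed (use gmax_pos w_nonneg c_zero in auto)

text \<open>A unit without no-load cost has minimum economic output \<open>0\<close> and so is not in \<open>I_hat\<close>.\<close>
lemma unit_with_no_load_cost_hat:
  assumes "i \<in> I_hat"
  shows "unit_with_no_load_cost (gmax i) (w i) (c i)"
proof -
  have i: "i \<in> I" using assms by (simp add: units_hat_def)
  interpret unit_data "gmax i" "w i" "c i" using i by (rule unit_data_unit)
  have "w i \<noteq> 0"
    using assms d_nonneg gm_pos by (auto simp: units_hat_def ec_min_def)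
  then show ?thesis
    using w_nonneg c_cont[OF i] by unfold_locales auto
qed

text \<open>
  The minimum economic output is at most the capacity, so what it exceeds is the demand.
\<close>
lemma d_less_output_min:
  assumes "i \<in> I_hat"
  shows "d < output_min i"
proof -
  interpret unit_with_no_load_cost "gmax i" "w i" "c i"
    using assms by (rule unit_with_no_load_cost_hat)
  show ?thesis using assms ec_min_le by (auto simp: units_hat_def)
qed

lemma profit_gap_mono:
  assumes "admissible e" "p \<le> q"
  shows "profit_gap e p \<le> profit_gap e q"
  unfolding profit_gap_def
proof (rule sum_mono)
  fix i assume i: "i \<in> I_hat"
  interpret unit_with_no_load_cost "gmax i" "w i" "c i"
    using i by (rule unit_with_no_load_cost_hat)
  show "\<pi> i p - \<pi>_hat i p (e i) \<le> \<pi> i q - \<pi>_hat i q (e i)"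
    using monoD[OF profit_minus_profit_hat_mono[OF d_nonneg] assms(2), of "e i"] assms(1) i
    by (simp add: admissible_def)
qed

text \<open>
  Lowering the price from \<open>p\<close> to the break-even price of a unit in \<open>I_hat\<close> costs \<open>d\<close> per unit of
  price in the linear term of the dual function but saves more than \<open>d\<close> in the profit of that unit.
\<close>
lemma ch_price_le_break_even:
  assumes p: "p \<in> ch_prices I gmax w c d" and i: "i \<in> I_hat"
  shows "p \<le> unit_with_no_load_cost.break_even_price (gmax i) (w i) (c i)"
proof -
  interpret unit_with_no_load_cost "gmax i" "w i" "c i"
    using i by (rule unit_with_no_load_cost_hat)
  show ?thesis
  proof (rule ccontr)
    let ?b = break_even_price
    assume "\<not> p \<le> ?b"
    then have b: "?b < p" by simp
    have iI: "i \<in> I" using i by (simp add: units_hat_def)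
    have "d * (p - ?b) < output_min i * (p - ?b)"
      using d_less_output_min[OF i] b by simp
    also have "\<dots> \<le> \<pi> i p - \<pi> i ?b"
      using profit_growth_above_break_even[of ?b p] b by simp
    also have "\<dots> \<le> (\<Sum>j\<in>I. \<pi> j p - \<pi> j ?b)"
      using finite_units iI b
      by (intro member_le_sum) (auto intro: unit_data.profit_mono[OF unit_data_unit])
    finally have "dual p < dual ?b"
      by (simp add: dual_def sum_subtractf algebra_simps)
    then show False using p by (auto simp: ch_prices_iff not_le[symmetric])
  qed
qed

lemma profit_gap_ch_price:
  assumes "admissible e" "p \<in> ch_prices I gmax w c d"
  shows "profit_gap e p = 0"
  unfolding profit_gap_def
proof (intro sum.neutral ballI)
  fix i assume i: "i \<in> I_hat"
  interpret unit_with_no_load_cost "gmax i" "w i" "c i"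
    using i by (rule unit_with_no_load_cost_hat)
  show "\<pi> i p - \<pi>_hat i p (e i) = 0"
    using profit_eq_profit_hat_below_break_even[OF d_nonneg, of "e i" p]
      ch_price_le_break_even[OF assms(2) i] assms(1) i by (simp add: admissible_def)
qed

lemma modified_price_dichotomy:
  assumes "admissible e" "p' \<in> modified_ch_prices I gmax w c d e"
  shows "p' \<in> ch_prices I gmax w c d \<or> (\<forall>p\<in>ch_prices I gmax w c d. p < p')"
proof (rule disjCI)
  assume "\<not> (\<forall>p\<in>ch_prices I gmax w c d. p < p')"
  then obtain p where p: "p \<in> ch_prices I gmax w c d" "p' \<le> p"
    by (auto simp: not_less)
  have "dual p + profit_gap e p \<le> dual p' + profit_gap e p'"
    using assms(2) by (simp add: modified_ch_prices_iff)
  then have "dual p \<le> dual p'"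
    using profit_gap_mono[OF assms(1) p(2)] by linarith
  moreover have "dual q \<le> dual p" for q
    using p(1) by (simp add: ch_prices_iff)
  ultimately have "dual q \<le> dual p'" for q
    by (rule order_trans[rotated])
  then show "p' \<in> ch_prices I gmax w c d"
    by (simp add: ch_prices_iff)
qed

lemma ch_prices_subset_modified:
  assumes "admissible e" "ch_prices I gmax w c d \<inter> modified_ch_prices I gmax w c d e \<noteq> {}"
  shows "ch_prices I gmax w c d \<subseteq> modified_ch_prices I gmax w c d e"
proof
  fix p assume p: "p \<in> ch_prices I gmax w c d"
  obtain q where q: "q \<in> ch_prices I gmax w c d" "q \<in> modified_ch_prices I gmax w c d e"
    using assms(2) by auto
  have "dual q \<le> dual p" using p by (simp add: ch_prices_iff)
  then have "dual q + profit_gap e q \<le> dual p + profit_gap e p"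
    using profit_gap_ch_price[OF assms(1)] p q(1) by simp
  moreover have "dual r + profit_gap e r \<le> dual q + profit_gap e q" for r
    using q(2) by (simp add: modified_ch_prices_iff)
  ultimately have "dual r + profit_gap e r \<le> dual p + profit_gap e p" for r
    by (rule order_trans[rotated])
  then show "p \<in> modified_ch_prices I gmax w c d e"
    by (simp add: modified_ch_prices_iff)
qed

lemma small_perturbations_admissible:
  "\<exists>\<epsilon>0>0. \<forall>e. (\<forall>i\<in>I_hat. 0 < e i \<and> e i < \<epsilon>0) \<longrightarrow> admissible e"
proof (intro exI conjI)
  \<comment> \<open>The inserted \<open>1\<close> keeps the minimum well-defined when \<open>I_hat\<close> is empty.\<close>
  let ?S = "insert 1 ((\<lambda>i. output_min i - d) ` I_hat)"
  have fin: "finite ?S" using finite_units by (simp add: units_hat_def)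
  then show "Min ?S > 0" using d_less_output_min by (simp add: Min_gr_iff)
  have Min_S: "Min ?S \<le> output_min i - d" if "i \<in> I_hat" for i
    using fin that by (intro Min_le) auto
  show "\<forall>e. (\<forall>i\<in>I_hat. 0 < e i \<and> e i < Min ?S) \<longrightarrow> admissible e"
    unfolding admissible_def using less_le_trans[OF _ Min_S] by blast
qed

end

theorem proposition6:
  fixes I :: "'i set"
    and gmax w :: "'i \<Rightarrow> real"
    and c :: "'i \<Rightarrow> real \<Rightarrow> real"
    and d :: real
    and \<epsilon> :: "'i \<Rightarrow> real"
  assumes "finite I" and "I \<noteq> {}"
    and "\<And>i. i \<in> I \<Longrightarrow> gmax i > 0"
    and "\<And>i. i \<in> I \<Longrightarrow> w i \<ge> 0"
    and "\<And>i. i \<in> I \<Longrightarrow> mono_on {0..gmax i} (c i)"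
    and "\<And>i. i \<in> I \<Longrightarrow> convex_on {0..gmax i} (c i)"
    and "\<And>i. i \<in> I \<Longrightarrow> continuous_on {0..gmax i} (c i)"
    and "\<And>i. i \<in> I \<Longrightarrow> c i 0 = 0"
    and "0 \<le> d" and "d \<le> (\<Sum>i\<in>I. gmax i)"
    and "\<And>i. i \<in> units_hat I gmax w c d \<Longrightarrow>
           0 < \<epsilon> i \<and> \<epsilon> i < ec_min (gmax i) (w i) (c i) - d"
  shows
    "(ch_prices I gmax w c d \<inter> modified_ch_prices I gmax w c d \<epsilon> \<noteq> {} \<longrightarrow>
        ch_prices I gmax w c d \<subseteq> modified_ch_prices I gmax w c d \<epsilon> \<and>
        (\<exists>\<epsilon>0>0. \<forall>\<epsilon>'. (\<forall>i\<in>units_hat I gmax w c d. 0 < \<epsilon>' i \<and> \<epsilon>' i < \<epsilon>0) \<longrightarrow>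
           (\<forall>p'\<in>modified_ch_prices I gmax w c d \<epsilon>'.
              p' \<in> ch_prices I gmax w c d \<or> (\<forall>p\<in>ch_prices I gmax w c d. p < p')))) \<and>
     (ch_prices I gmax w c d \<inter> modified_ch_prices I gmax w c d \<epsilon> = {} \<longrightarrow>
        (\<forall>p\<in>ch_prices I gmax w c d. \<forall>p'\<in>modified_ch_prices I gmax w c d \<epsilon>. p < p'))"
proof -
  interpret market I gmax w c d
    using assms by unfold_locales auto
  have adm: "admissible \<epsilon>"
    using assms(11) by (simp add: admissible_def)
  obtain \<epsilon>0 where "\<epsilon>0 > 0"
    and small: "\<And>e. \<forall>i\<in>I_hat. 0 < e i \<and> e i < \<epsilon>0 \<Longrightarrow> admissible e"
    using small_perturbations_admissible by blast
  then have "\<exists>\<epsilon>0>0. \<forall>e. (\<forall>i\<in>I_hat. 0 < e i \<and> e i < \<epsilon>0) \<longrightarrow>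
      (\<forall>p'\<in>modified_ch_prices I gmax w c d e.
         p' \<in> ch_prices I gmax w c d \<or> (\<forall>p\<in>ch_prices I gmax w c d. p < p'))"
    using modified_price_dichotomy by (intro exI[of _ \<epsilon>0]) auto
  moreover have "p < p'" if "ch_prices I gmax w c d \<inter> modified_ch_prices I gmax w c d \<epsilon> = {}"
    "p \<in> ch_prices I gmax w c d" "p' \<in> modified_ch_prices I gmax w c d \<epsilon>" for p p'
    using modified_price_dichotomy[OF adm that(3)] that by auto
  ultimately show ?thesis
    using ch_prices_subset_modified[OF adm] by auto
qed

end
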